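(* For any modal formula $A$, the following are equivalent: (1) $\mathbf{NR}\vdash A$; (2) $A$ is valid in all serial $\mathbf{N}$-frames; (3) $A$ is valid in all finite serial $\mathbf{N}$-frames; (4) $A$ is valid in all finite $\mathrm{Sub}(A)$-serial $\mathbf{N}$-frames.
   Context: Modal formulas are built from propositional variables and $\bot$ using $\neg,\land,\lor,\to$ and $\Box$; $\mathrm{Sub}(A)$ is the set of subformulas of $A$. $\mathbf{N}$ has all propositional tautologies as axioms and Modus Ponens and Necessitation $A/\Box A$ as rules; $\mathbf{NR}$ is $\mathbf{N}$ plus the rule $\neg B/\neg\Box B$. An $\mathbf{N}$-frame is $(W, \{\prec_B\}_B)$ with $W$ nonempty and a binary relation $\prec_B$ on $W$ for each modal formula $B$ (finite if $W$ is finite); an $\mathbf{N}$-model adds $\Vdash$ with usual propositional clauses and $x\Vdash\Box B$ iff $y\Vdash B$ for all $y$ with $x\prec_B y$. Validity in a frame means truth at all worlds of all models on the frame. The frame is $B$-serial if every $x$ has some $y$ with $x\prec_B y$; it is $\Gamma$-serial for a set $\Gamma$ of formulas if it is $B$-serial for every $B$ with $\Box B\in\Gamma$; it is serial if it is $B$-serial for all $B$. *)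

theory Defs
  imports "HOL-Library.Infinite_Typeclass"
begin

datatype 'p fm =
    Var 'p
  | Bot
  | Neg "'p fm"
  | Conj "'p fm" "'p fm"
  | Disj "'p fm" "'p fm"
  | Imp "'p fm" "'p fm"
  | Box "'p fm"

fun Sub :: "'p fm \<Rightarrow> 'p fm set" where
  "Sub (Var p) = {Var p}"
| "Sub Bot = {Bot}"
| "Sub (Neg B) = insert (Neg B) (Sub B)"
| "Sub (Conj B C) = insert (Conj B C) (Sub B \<union> Sub C)"
| "Sub (Disj B C) = insert (Disj B C) (Sub B \<union> Sub C)"
| "Sub (Imp B C) = insert (Imp B C) (Sub B \<union> Sub C)"
| "Sub (Box B) = insert (Box B) (Sub B)"

text \<open>Truth-table evaluation of modal formulas, in which the variables and the formulas
  \<open>Box B\<close> are the atoms: \<open>v\<close> assigns truth values to the former, \<open>b\<close> to the latter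
  (as a function of \<open>B\<close>).\<close>

fun peval :: "('p \<Rightarrow> bool) \<Rightarrow> ('p fm \<Rightarrow> bool) \<Rightarrow> 'p fm \<Rightarrow> bool" where
  "peval v b (Var p) \<longleftrightarrow> v p"
| "peval v b Bot \<longleftrightarrow> False"
| "peval v b (Neg B) \<longleftrightarrow> \<not> peval v b B"
| "peval v b (Conj B C) \<longleftrightarrow> peval v b B \<and> peval v b C"
| "peval v b (Disj B C) \<longleftrightarrow> peval v b B \<or> peval v b C"
| "peval v b (Imp B C) \<longleftrightarrow> (peval v b B \<longrightarrow> peval v b C)"
| "peval v b (Box B) \<longleftrightarrow> b B"

definition tautology :: "'p fm \<Rightarrow> bool" where
  "tautology A \<longleftrightarrow> (\<forall>v b. peval v b A)"

inductive NR_provable :: "'p fm \<Rightarrow> bool" where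
  Taut: "tautology A \<Longrightarrow> NR_provable A"
| MP: "NR_provable A \<Longrightarrow> NR_provable (Imp A B) \<Longrightarrow> NR_provable B"
| Nec: "NR_provable A \<Longrightarrow> NR_provable (Box A)"
| Ros: "NR_provable (Neg B) \<Longrightarrow> NR_provable (Neg (Box B))"

text \<open>Worlds are drawn from a type \<open>'w\<close>. Statements about all frames leave \<open>'w\<close> an arbitrary
  infinite type: every finite frame has an isomorphic copy inside any such type, and every
  frame lives inside some such type.\<close>

locale N_frame =
  fixes W :: "'w set" and R :: "'p fm \<Rightarrow> ('w \<times> 'w) set"
  assumes nonempty: "W \<noteq> {}"
    and rel_on: "R B \<subseteq> W \<times> W"

text \<open>The forcing relation \<open>S\<close> is arbitrary on variables, and irrelevant outside \<open>W\<close>.\<close>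

locale N_model = N_frame W R
  for W :: "'w set" and R :: "'p fm \<Rightarrow> ('w \<times> 'w) set" +
  fixes S :: "'w \<Rightarrow> 'p fm \<Rightarrow> bool"
  assumes forces_Bot: "x \<in> W \<Longrightarrow> \<not> S x Bot"
    and forces_Neg: "x \<in> W \<Longrightarrow> S x (Neg B) \<longleftrightarrow> \<not> S x B"
    and forces_Conj: "x \<in> W \<Longrightarrow> S x (Conj B C) \<longleftrightarrow> S x B \<and> S x C"
    and forces_Disj: "x \<in> W \<Longrightarrow> S x (Disj B C) \<longleftrightarrow> S x B \<or> S x C"
    and forces_Imp: "x \<in> W \<Longrightarrow> S x (Imp B C) \<longleftrightarrow> (S x B \<longrightarrow> S x C)"
    and forces_Box: "x \<in> W \<Longrightarrow> S x (Box B) \<longleftrightarrow> (\<forall>y. (x, y) \<in> R B \<longrightarrow> S y B)"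

definition valid_in :: "'w set \<Rightarrow> ('p fm \<Rightarrow> ('w \<times> 'w) set) \<Rightarrow> 'p fm \<Rightarrow> bool" where
  "valid_in W R A \<longleftrightarrow> (\<forall>S. N_model W R S \<longrightarrow> (\<forall>x\<in>W. S x A))"

definition fm_serial :: "'w set \<Rightarrow> ('p fm \<Rightarrow> ('w \<times> 'w) set) \<Rightarrow> 'p fm \<Rightarrow> bool" where
  "fm_serial W R B \<longleftrightarrow> (\<forall>x\<in>W. \<exists>y\<in>W. (x, y) \<in> R B)"

definition set_serial :: "'w set \<Rightarrow> ('p fm \<Rightarrow> ('w \<times> 'w) set) \<Rightarrow> 'p fm set \<Rightarrow> bool" where
  "set_serial W R \<Gamma> \<longleftrightarrow> (\<forall>B. Box B \<in> \<Gamma> \<longrightarrow> fm_serial W R B)"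

definition serial :: "'w set \<Rightarrow> ('p fm \<Rightarrow> ('w \<times> 'w) set) \<Rightarrow> bool" where
  "serial W R \<longleftrightarrow> (\<forall>B. fm_serial W R B)"

end

theory Submission
  imports Defs "HOL-Library.Equipollence"
begin

text \<open>
  Soundness for serial frames is an induction on proofs. A \<open>Sub A\<close>-serial frame becomes serial when
  the relations of the formulas \<open>B\<close> with \<open>Box B \<notin> Sub A\<close> are replaced by the total relation, and
  this does not affect the truth of \<open>A\<close>.

  For completeness, call a truth assignment admissible if, for all \<open>Box B \<in> Sub A\<close>, it makes
  \<open>Box B\<close> true when \<open>B\<close> is provable and false when \<open>Neg B\<close> is. These constraints amount to the
  truth of finitely many theorems, so every unprovable formula is false under some admissible
  assignment. The worlds are admissible assignments, one refuting each unprovable formula among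
  \<open>B\<close> and \<open>Neg B\<close> for \<open>B \<in> Sub A\<close>; the world \<open>x\<close> sees \<open>y\<close> via \<open>B\<close> unless \<open>x\<close> makes \<open>Box B\<close> true
  and \<open>y\<close> makes \<open>B\<close> false. If \<open>x\<close> makes \<open>Box B\<close> true, then \<open>Neg B\<close> is unprovable and some world
  makes \<open>B\<close> true, which gives seriality; if \<open>x\<close> makes \<open>Box B\<close> false, then \<open>B\<close> is unprovable and
  some world makes \<open>B\<close> false, which gives the truth lemma.
\<close>

lemma Sub_refl [simp]: "A \<in> Sub A"
  by (cases A) auto

lemma finite_Sub [simp]: "finite (Sub A)"
  by (induction A) auto

lemma Box_in_SubD: "Box B \<in> Sub A \<Longrightarrow> B \<in> Sub A"
  by (induction A) auto

fun forces :: "('p fm \<Rightarrow> ('w \<times> 'w) set) \<Rightarrow> ('w \<Rightarrow> 'p \<Rightarrow> bool) \<Rightarrow> 'w \<Rightarrow> 'p fm \<Rightarrow> bool" where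
  "forces R V x (Var p) \<longleftrightarrow> V x p"
| "forces R V x Bot \<longleftrightarrow> False"
| "forces R V x (Neg B) \<longleftrightarrow> \<not> forces R V x B"
| "forces R V x (Conj B C) \<longleftrightarrow> forces R V x B \<and> forces R V x C"
| "forces R V x (Disj B C) \<longleftrightarrow> forces R V x B \<or> forces R V x C"
| "forces R V x (Imp B C) \<longleftrightarrow> (forces R V x B \<longrightarrow> forces R V x C)"
| "forces R V x (Box B) \<longleftrightarrow> (\<forall>y. (x, y) \<in> R B \<longrightarrow> forces R V y B)"

lemma forces_eq_peval: "forces R V x A \<longleftrightarrow> peval (V x) (\<lambda>B. forces R V x (Box B)) A"
  by (induction A) simp_all

lemma forces_cong_Sub:
  assumes "\<And>B. Box B \<in> Sub A \<Longrightarrow> R B = R' B"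
  shows "forces R V x A \<longleftrightarrow> forces R' V x A"
  using assms by (induction A arbitrary: x) simp_all

lemma N_model_forces: "N_frame W R \<Longrightarrow> N_model W R (forces R V)"
  by (simp add: N_model_def N_model_axioms_def)

lemma (in N_model) eq_forces: "x \<in> W \<Longrightarrow> S x A \<longleftrightarrow> forces R (\<lambda>y p. S y (Var p)) x A"
proof (induction A arbitrary: x)
  case (Box B)
  then show ?case
    using rel_on[of B] by (auto simp: forces_Box)
qed (simp_all add: forces_Bot forces_Neg forces_Conj forces_Disj forces_Imp)

lemma valid_in_iff_forces:
  assumes "N_frame W R"
  shows "valid_in W R A \<longleftrightarrow> (\<forall>V. \<forall>x\<in>W. forces R V x A)"
proof
  show "valid_in W R A \<Longrightarrow> \<forall>V. \<forall>x\<in>W. forces R V x A"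
    using N_model_forces[OF assms] unfolding valid_in_def by blast
  show "\<forall>V. \<forall>x\<in>W. forces R V x A \<Longrightarrow> valid_in W R A"
    by (simp add: valid_in_def N_model.eq_forces)
qed

lemma NR_sound:
  assumes "NR_provable A" and "N_frame W R" and "serial W R"
  shows "valid_in W R A"
proof -
  have "forces R V x A" if "x \<in> W" for V x
    using assms(1) that
  proof (induction arbitrary: x)
    case (Taut A)
    then show ?case
      using forces_eq_peval[of R V x A] by (simp add: tautology_def)
  next
    case (MP A B)
    then show ?case
      by simp
  next
    case (Nec A)
    then show ?case
      using N_frame.rel_on[OF assms(2)] by auto
  next
    case (Ros B)
    obtain y where "y \<in> W" "(x, y) \<in> R B"
      using assms(3) Ros.prems unfolding serial_def fm_serial_def by blast
    then show ?case
      using Ros.IH by auto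
  qed
  then show ?thesis
    by (simp add: valid_in_iff_forces[OF assms(2)])
qed

definition totalize_outside ::
    "'p fm set \<Rightarrow> 'w set \<Rightarrow> ('p fm \<Rightarrow> ('w \<times> 'w) set) \<Rightarrow> 'p fm \<Rightarrow> ('w \<times> 'w) set" where
  "totalize_outside \<Gamma> W R B = (if Box B \<in> \<Gamma> then R B else W \<times> W)"

lemma N_frame_totalize_outside: "N_frame W R \<Longrightarrow> N_frame W (totalize_outside \<Gamma> W R)"
  by (simp add: N_frame_def totalize_outside_def)

lemma serial_totalize_outside: "set_serial W R \<Gamma> \<Longrightarrow> serial W (totalize_outside \<Gamma> W R)"
  by (auto simp: serial_def set_serial_def fm_serial_def totalize_outside_def)

lemma valid_in_totalize_outside:
  assumes "N_frame W R" and "Sub A \<subseteq> \<Gamma>"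
  shows "valid_in W (totalize_outside \<Gamma> W R) A \<longleftrightarrow> valid_in W R A"
proof -
  have "forces (totalize_outside \<Gamma> W R) V x A \<longleftrightarrow> forces R V x A" for V x
    using assms(2) by (intro forces_cong_Sub) (auto simp: totalize_outside_def)
  then show ?thesis
    using assms(1) by (simp add: valid_in_iff_forces N_frame_totalize_outside)
qed

lemma NR_tautological_consequence:
  assumes "finite \<Gamma>" and "\<And>C. C \<in> \<Gamma> \<Longrightarrow> NR_provable C"
    and "\<And>v b. (\<And>C. C \<in> \<Gamma> \<Longrightarrow> peval v b C) \<Longrightarrow> peval v b D"
  shows "NR_provable D"
  using assms
proof (induction \<Gamma> arbitrary: D rule: finite_induct)
  case empty
  then show ?case
    by (simp add: NR_provable.Taut tautology_def)
next
  case (insert C \<Gamma>)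
  have "NR_provable (Imp C D)"
  proof (rule insert.IH)
    show "NR_provable E" if "E \<in> \<Gamma>" for E
      using insert.prems(1) that by simp
    show "peval v b (Imp C D)" if "\<And>E. E \<in> \<Gamma> \<Longrightarrow> peval v b E" for v b
      using insert.prems(2)[of v b] that by auto
  qed
  then show ?case
    using NR_provable.MP insert.prems(1) by blast
qed

definition admissible :: "'p fm set \<Rightarrow> ('p fm \<Rightarrow> bool) \<Rightarrow> bool" where
  "admissible \<Gamma> b \<longleftrightarrow> (\<forall>B. Box B \<in> \<Gamma> \<longrightarrow>
     (NR_provable B \<longrightarrow> b B) \<and> (NR_provable (Neg B) \<longrightarrow> \<not> b B))"

lemma NR_provable_if_admissible_peval:
  assumes "finite \<Gamma>" and "\<And>v b. admissible \<Gamma> b \<Longrightarrow> peval v b C"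
  shows "NR_provable C"
proof (rule NR_tautological_consequence)
  let ?\<Delta> = "{D \<in> \<Gamma> \<union> Neg ` \<Gamma>. NR_provable D}"
  show "finite ?\<Delta>"
    using assms(1) by simp
  show "NR_provable D" if "D \<in> ?\<Delta>" for D
    using that by simp
  show "peval v b C" if true: "\<And>D. D \<in> ?\<Delta> \<Longrightarrow> peval v b D" for v b
  proof (rule assms(2), unfold admissible_def, intro allI impI conjI)
    fix B assume "Box B \<in> \<Gamma>"
    then show "b B" if "NR_provable B"
      using true[of "Box B"] that by (simp add: NR_provable.Nec)
    show "\<not> b B" if "NR_provable (Neg B)"
      using true[of "Neg (Box B)"] that \<open>Box B \<in> \<Gamma>\<close> by (simp add: NR_provable.Ros)
  qed
qed

lemma finite_admissible_family:
  fixes \<Gamma> \<Delta> :: "'p fm set"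
  assumes "finite \<Gamma>" and "finite \<Delta>"
  obtains W :: "'w::infinite set" and V b
  where "finite W" and "\<And>x. x \<in> W \<Longrightarrow> admissible \<Gamma> (b x)"
    and "\<And>C. C \<in> \<Delta> \<Longrightarrow> \<not> NR_provable C \<Longrightarrow> \<exists>x\<in>W. \<not> peval (V x) (b x) C"
proof -
  obtain v b where refutes:
    "\<And>C. \<not> NR_provable C \<Longrightarrow> admissible \<Gamma> (b C) \<and> \<not> peval (v C) (b C) C"
    using NR_provable_if_admissible_peval[OF assms(1)] by metis
  define U where "U = {C \<in> \<Delta>. \<not> NR_provable C}"
  have "finite U"
    using assms(2) by (simp add: U_def)
  then obtain f :: "'p fm \<Rightarrow> 'w" where f: "inj_on f U"
    using finite_lepoll_infinite[OF infinite_UNIV] unfolding lepoll_def by blast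
  define g where "g = inv_into U f"
  have g_f: "g (f C) = C" if "C \<in> U" for C
    using f that by (simp add: g_def)
  show thesis
  proof
    show "finite (f ` U)"
      using \<open>finite U\<close> by simp
    show "admissible \<Gamma> ((b \<circ> g) x)" if "x \<in> f ` U" for x
      using refutes g_f that by (auto simp: U_def)
    show "\<exists>x\<in>f ` U. \<not> peval ((v \<circ> g) x) ((b \<circ> g) x) C"
      if "C \<in> \<Delta>" "\<not> NR_provable C" for C
      using refutes g_f that by (auto simp: U_def)
  qed
qed

definition canonical_rel ::
    "'w set \<Rightarrow> ('w \<Rightarrow> 'p \<Rightarrow> bool) \<Rightarrow> ('w \<Rightarrow> 'p fm \<Rightarrow> bool) \<Rightarrow> 'p fm \<Rightarrow> ('w \<times> 'w) set" where
  "canonical_rel W V b B = {(x, y) \<in> W \<times> W. b x B \<longrightarrow> peval (V y) (b y) B}"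

lemma N_frame_canonical_rel: "W \<noteq> {} \<Longrightarrow> N_frame W (canonical_rel W V b)"
  by (auto simp: N_frame_def canonical_rel_def)

lemma set_serial_canonical_rel:
  assumes "\<And>x B. x \<in> W \<Longrightarrow> Box B \<in> \<Gamma> \<Longrightarrow> b x B \<Longrightarrow> \<exists>y\<in>W. peval (V y) (b y) B"
  shows "set_serial W (canonical_rel W V b) \<Gamma>"
  using assms unfolding set_serial_def fm_serial_def canonical_rel_def by blast

lemma forces_canonical_rel:
  assumes "\<And>x B. x \<in> W \<Longrightarrow> Box B \<in> Sub A \<Longrightarrow> \<not> b x B \<Longrightarrow> \<exists>y\<in>W. \<not> peval (V y) (b y) B"
    and "x \<in> W"
  shows "forces (canonical_rel W V b) V x A \<longleftrightarrow> peval (V x) (b x) A"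
  using assms
proof (induction A arbitrary: x)
  case (Box B)
  have IH: "forces (canonical_rel W V b) V y B \<longleftrightarrow> peval (V y) (b y) B" if "y \<in> W" for y
    using Box.IH Box.prems(1) that by simp
  have "forces (canonical_rel W V b) V x (Box B) \<longleftrightarrow>
      (\<forall>y. (x, y) \<in> canonical_rel W V b B \<longrightarrow> peval (V y) (b y) B)"
    using IH by (auto simp: canonical_rel_def[of W V b B])
  also have "\<dots> \<longleftrightarrow> b x B"
    using Box.prems(1)[of x B] Box.prems(2) by (auto simp: canonical_rel_def)
  finally show ?case
    by simp
qed simp_all

lemma NR_finite_countermodel:
  fixes A :: "'p fm"
  assumes "\<not> NR_provable A"
  obtains W :: "'w::infinite set" and R
  where "N_frame W R" and "finite W" and "set_serial W R (Sub A)" and "\<not> valid_in W R A"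
proof -
  have "finite (Sub A \<union> Neg ` Sub A)"
    by simp
  with finite_Sub obtain W :: "'w set" and V b where "finite W"
    and admissible: "\<And>x. x \<in> W \<Longrightarrow> admissible (Sub A) (b x)"
    and refuted: "\<And>C. C \<in> Sub A \<union> Neg ` Sub A \<Longrightarrow> \<not> NR_provable C \<Longrightarrow>
      \<exists>x\<in>W. \<not> peval (V x) (b x) C"
    by (rule finite_admissible_family) blast
  let ?R = "canonical_rel W V b"
  obtain z where z: "z \<in> W" "\<not> peval (V z) (b z) A"
    using refuted[of A] assms by auto
  then have frame: "N_frame W ?R"
    by (intro N_frame_canonical_rel) auto
  have serial: "set_serial W ?R (Sub A)"
  proof (rule set_serial_canonical_rel)
    fix x B assume "x \<in> W" "Box B \<in> Sub A" "b x B"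
    then have "\<not> NR_provable (Neg B)" "B \<in> Sub A"
      using admissible by (auto simp: admissible_def Box_in_SubD)
    then show "\<exists>y\<in>W. peval (V y) (b y) B"
      using refuted[of "Neg B"] by simp
  qed
  have "forces ?R V z A \<longleftrightarrow> peval (V z) (b z) A"
  proof (rule forces_canonical_rel[OF _ z(1)])
    fix x B assume "x \<in> W" "Box B \<in> Sub A" "\<not> b x B"
    then have "\<not> NR_provable B" "B \<in> Sub A"
      using admissible by (auto simp: admissible_def Box_in_SubD)
    then show "\<exists>y\<in>W. \<not> peval (V y) (b y) B"
      using refuted by simp
  qed
  then have "\<not> valid_in W ?R A"
    using z by (auto simp: valid_in_iff_forces[OF frame])
  with frame \<open>finite W\<close> serial show thesis
    by (rule that)
qed

theorem theorem3p12:
  fixes A :: "'p fm"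
  shows "(NR_provable A \<longleftrightarrow>
            (\<forall>(W :: 'w::infinite set) R. N_frame W R \<and> serial W R \<longrightarrow> valid_in W R A))
       \<and> (NR_provable A \<longleftrightarrow>
            (\<forall>(W :: 'w set) R. N_frame W R \<and> finite W \<and> serial W R \<longrightarrow> valid_in W R A))
       \<and> (NR_provable A \<longleftrightarrow>
            (\<forall>(W :: 'w set) R. N_frame W R \<and> finite W \<and> set_serial W R (Sub A) \<longrightarrow> valid_in W R A))"
    (is "(_ \<longleftrightarrow> ?serial) \<and> (_ \<longleftrightarrow> ?finite_serial) \<and> (_ \<longleftrightarrow> ?finite_Sub_serial)")
proof -
  have "NR_provable A \<Longrightarrow> ?serial"
    by (simp add: NR_sound)
  moreover have "?serial \<Longrightarrow> ?finite_serial"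
    by simp
  moreover have ?finite_Sub_serial if ?finite_serial
  proof (intro allI impI, elim conjE)
    fix W :: "'w set" and R
    assume frame: "N_frame W R" and "finite W" "set_serial W R (Sub A)"
    then have "valid_in W (totalize_outside (Sub A) W R) A"
      using that by (simp add: N_frame_totalize_outside serial_totalize_outside)
    then show "valid_in W R A"
      by (simp add: valid_in_totalize_outside[OF frame])
  qed
  moreover have "NR_provable A" if ?finite_Sub_serial
  proof (rule ccontr)
    assume "\<not> NR_provable A"
    then show False
      by (rule NR_finite_countermodel) (use that in blast)
  qed
  ultimately show ?thesis
    by argo
qed

end
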